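(* I. Let $\mathbf{H}$ be a structure for the signature $(0,+,\rightarrow)$. Then $\mathbf{H}$ is a hoop if and only if $(H;0,+)$ is a commutative monoid and $\mathbf{H}$ satisfies the following equations: 1. $x\rightarrow x=0$; 2. $x\rightarrow 0=0$; 3. $x+y\rightarrow z=x\rightarrow (y\rightarrow z)$; 4. $x+(x\rightarrow y)=y+(y\rightarrow x)$. II. Let $\mathbf{H}$ be a structure for the signature $(0,1,+,\rightarrow)$. Then $\mathbf{H}$ is a bounded hoop (with annihilator $1$) if and only if $(H;0,+)$ is a commutative monoid and $\mathbf{H}$ satisfies equations 1 to 4 and also 5. $1\rightarrow x=0$.
   Context: The symbols $0$ and $1$ are constants and $+$, $\rightarrow$ are binary operations; $\rightarrow$ binds less tightly than $+$. A pocrim is a structure $\mathbf{P}=(P;0,+,\rightarrow)$ such that, writing $x\ge y$ for $x\rightarrow y=0$: $(P;0,+)$ is a commutative monoid; $x\ge x$; $x\ge y$ and $y\ge z$ imply $x\ge z$; $x\ge y$ and $y\ge x$ imply $x=y$; $x\ge y$ implies $x+z\ge y+z$; $x\ge 0$; and $x+y\ge z$ iff $x\ge y\rightarrow z$. A hoop is a pocrim satisfying $x+(x\rightarrow y)=y+(y\rightarrow x)$. A pocrim is bounded with annihilator $1$ if $x+1=1$ for all $x$. *)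

theory Defs
  imports Main
begin

text \<open>
  The carrier of a structure is a whole type, which imposes no restriction because the type is
  arbitrary. The ordering runs so that \<open>\<zero>\<close> is the least element. Implication binds
  less tightly than addition, and both bind more tightly than the order and equality.
\<close>

locale pocrim_signature =
  fixes zero :: 'a  (\<open>\<zero>\<close>)
    and plus :: "'a \<Rightarrow> 'a \<Rightarrow> 'a"  (infixl \<open>\<oplus>\<close> 65)
    and imp :: "'a \<Rightarrow> 'a \<Rightarrow> 'a"  (infixr \<open>\<rightarrow>\<close> 60)
begin

definition geq :: "'a \<Rightarrow> 'a \<Rightarrow> bool"  (infix \<open>\<succeq>\<close> 50)
  where "x \<succeq> y \<longleftrightarrow> x \<rightarrow> y = \<zero>"

end

locale pocrim = pocrim_signature + add: comm_monoid plus zero +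
  assumes refl: "x \<succeq> x"
    and trans: "x \<succeq> y \<Longrightarrow> y \<succeq> z \<Longrightarrow> x \<succeq> z"
    and antisym: "x \<succeq> y \<Longrightarrow> y \<succeq> x \<Longrightarrow> x = y"
    and add_mono: "x \<succeq> y \<Longrightarrow> x \<oplus> z \<succeq> y \<oplus> z"
    and geq_zero: "x \<succeq> \<zero>"
    and residuation: "x \<oplus> y \<succeq> z \<longleftrightarrow> x \<succeq> y \<rightarrow> z"

locale hoop = pocrim +
  assumes divisibility: "x \<oplus> (x \<rightarrow> y) = y \<oplus> (y \<rightarrow> x)"

locale bounded_pocrim = pocrim zero plus imp
  for zero :: 'a  (\<open>\<zero>\<close>)
    and one :: 'a  (\<open>\<one>\<close>)
    and plus :: "'a \<Rightarrow> 'a \<Rightarrow> 'a"  (infixl \<open>\<oplus>\<close> 65)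
    and imp :: "'a \<Rightarrow> 'a \<Rightarrow> 'a"  (infixr \<open>\<rightarrow>\<close> 60) +
  assumes annihilator: "x \<oplus> \<one> = \<one>"

locale bounded_hoop = bounded_pocrim + hoop

end

theory Submission
  imports Defs
begin

text \<open>In a pocrim, residuation turns the currying equation \<open>plus_imp\<close> into
  associativity of addition. Conversely, equation 4 says that x \<succeq> y makes x a sum with
  summand y, namely y \<oplus> (y \<rightarrow> x); \<open>hoopI\<close> combines this with currying
  to recover the order axioms. For the bounded case, \<open>annihilator_iff\<close> identifies
  annihilators with greatest elements, and being greatest is exactly equation 5.\<close>

context pocrim
begin

text \<open>An element u lies above either side exactly when u \<oplus> x \<oplus> y \<succeq> z.
  Taking u to be each side in turn, antisymmetry gives equality.\<close>

lemma plus_imp: "x \<oplus> y \<rightarrow> z = x \<rightarrow> (y \<rightarrow> z)"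
proof -
  have "u \<succeq> (x \<oplus> y \<rightarrow> z) \<longleftrightarrow> u \<succeq> (x \<rightarrow> (y \<rightarrow> z))" for u
    by (simp add: residuation [symmetric] add.assoc [symmetric])
  then show ?thesis
    by (meson antisym refl)
qed

lemma geq_plus: "x \<oplus> y \<succeq> y"
  using add_mono [OF geq_zero, of x y] by simp

text \<open>A sum dominates each summand. So a = a \<oplus> x \<succeq> x if a annihilates, while x
  \<oplus> a \<succeq> a always holds and a greatest a gives the reverse.\<close>

lemma annihilator_iff: "(\<forall>x. x \<oplus> a = a) \<longleftrightarrow> (\<forall>x. a \<succeq> x)"
proof
  assume "\<forall>x. x \<oplus> a = a"
  then show "\<forall>x. a \<succeq> x"
    by (metis geq_plus add.commute)
next
  assume "\<forall>x. a \<succeq> x"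
  then show "\<forall>x. x \<oplus> a = a"
    by (blast intro: antisym geq_plus)
qed

end

lemma hoopI:
  fixes zero :: 'a  (\<open>\<zero>\<close>)
    and plus :: "'a \<Rightarrow> 'a \<Rightarrow> 'a"  (infixl \<open>\<oplus>\<close> 65)
    and imp :: "'a \<Rightarrow> 'a \<Rightarrow> 'a"  (infixr \<open>\<rightarrow>\<close> 60)
  assumes "comm_monoid (\<oplus>) \<zero>"
    and imp_self: "\<And>x. x \<rightarrow> x = \<zero>"
    and imp_zero: "\<And>x. x \<rightarrow> \<zero> = \<zero>"
    and plus_imp: "\<And>x y z. x \<oplus> y \<rightarrow> z = x \<rightarrow> (y \<rightarrow> z)"
    and divisibility: "\<And>x y. x \<oplus> (x \<rightarrow> y) = y \<oplus> (y \<rightarrow> x)"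
  shows "hoop \<zero> (\<oplus>) (\<rightarrow>)"
proof -
  interpret comm_monoid "(\<oplus>)" \<zero> by fact
  interpret pocrim_signature \<zero> "(\<oplus>)" "(\<rightarrow>)" .
  \<comment> \<open>Here x \<rightarrow> y vanishes, so the left side of divisibility collapses to
    x.\<close>
  have decompose: "x = (y \<rightarrow> x) \<oplus> y" if "x \<succeq> y" for x y
    using divisibility [of x y] that by (simp add: geq_def commute)
  show ?thesis
  proof
    fix x y z
    show "x \<succeq> z" if "x \<succeq> y" "y \<succeq> z"
    proof -
      \<comment> \<open>Decompose x over y, then curry; the inner y \<rightarrow> z vanishes by
        assumption.\<close>
      have "x \<rightarrow> z = (y \<rightarrow> x) \<rightarrow> (y \<rightarrow> z)"
        using decompose [OF that(1)] plus_imp by metis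
      with that(2) show ?thesis
        by (simp add: geq_def imp_zero)
    qed
    show "x = y" if "x \<succeq> y" "y \<succeq> x"
      using divisibility [of x y] that by (simp add: geq_def)
    show "x \<oplus> z \<succeq> y \<oplus> z" if "x \<succeq> y"
    proof -
      \<comment> \<open>With y \<oplus> z as a summand, currying leaves the self-implication of y
        \<oplus> z inside, which is \<zero>.\<close>
      have "x \<oplus> z = (y \<rightarrow> x) \<oplus> (y \<oplus> z)"
        using decompose [OF that] assoc by metis
      then show ?thesis
        by (simp only: geq_def plus_imp [of "y \<rightarrow> x"] imp_self imp_zero)
    qed
  \<comment> \<open>Residuation is currying with both sides compared to \<zero>.\<close>
  qed (simp_all add: geq_def imp_self imp_zero plus_imp divisibility)
qed

theorem theorem3p2p2:
  fixes zero :: 'a  (\<open>\<zero>\<close>)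
    and one :: 'a  (\<open>\<one>\<close>)
    and plus :: "'a \<Rightarrow> 'a \<Rightarrow> 'a"  (infixl \<open>\<oplus>\<close> 65)
    and imp :: "'a \<Rightarrow> 'a \<Rightarrow> 'a"  (infixr \<open>\<rightarrow>\<close> 60)
  shows "(hoop \<zero> (\<oplus>) (\<rightarrow>) \<longleftrightarrow>
      comm_monoid (\<oplus>) \<zero> \<and>
      (\<forall>x. x \<rightarrow> x = \<zero>) \<and>
      (\<forall>x. x \<rightarrow> \<zero> = \<zero>) \<and>
      (\<forall>x y z. x \<oplus> y \<rightarrow> z = x \<rightarrow> (y \<rightarrow> z)) \<and>
      (\<forall>x y. x \<oplus> (x \<rightarrow> y) = y \<oplus> (y \<rightarrow> x)))
    \<and>
    (bounded_hoop \<zero> \<one> (\<oplus>) (\<rightarrow>) \<longleftrightarrow>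
      comm_monoid (\<oplus>) \<zero> \<and>
      (\<forall>x. x \<rightarrow> x = \<zero>) \<and>
      (\<forall>x. x \<rightarrow> \<zero> = \<zero>) \<and>
      (\<forall>x y z. x \<oplus> y \<rightarrow> z = x \<rightarrow> (y \<rightarrow> z)) \<and>
      (\<forall>x y. x \<oplus> (x \<rightarrow> y) = y \<oplus> (y \<rightarrow> x)) \<and>
      (\<forall>x. \<one> \<rightarrow> x = \<zero>))"
proof -
  have hoop_iff: "hoop \<zero> (\<oplus>) (\<rightarrow>) \<longleftrightarrow>
      comm_monoid (\<oplus>) \<zero> \<and>
      (\<forall>x. x \<rightarrow> x = \<zero>) \<and>
      (\<forall>x. x \<rightarrow> \<zero> = \<zero>) \<and>
      (\<forall>x y z. x \<oplus> y \<rightarrow> z = x \<rightarrow> (y \<rightarrow> z)) \<and>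
      (\<forall>x y. x \<oplus> (x \<rightarrow> y) = y \<oplus> (y \<rightarrow> x))" (is "?hoop \<longleftrightarrow> ?equations")
  proof
    assume ?hoop
    then interpret hoop \<zero> "(\<oplus>)" "(\<rightarrow>)" .
    show ?equations
      using add.comm_monoid_axioms refl geq_zero plus_imp divisibility
      unfolding geq_def by blast
  next
    assume ?equations
    then show ?hoop
      by (blast intro: hoopI)
  qed
  have "bounded_hoop \<zero> \<one> (\<oplus>) (\<rightarrow>) \<longleftrightarrow> ?hoop \<and> (\<forall>x. x \<oplus> \<one> = \<one>)"
    by (auto simp: bounded_hoop_def bounded_pocrim_def bounded_pocrim_axioms_def hoop_def)
  also have "\<dots> \<longleftrightarrow> ?hoop \<and> (\<forall>x. \<one> \<rightarrow> x = \<zero>)"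
    using pocrim.annihilator_iff pocrim_signature.geq_def
    by (metis hoop_def)
  finally show ?thesis
    unfolding hoop_iff by blast
qed

end
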